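(* Let $\beta\in(0,1]$ and let $Y_t=2N(t)-t$ be the simple ADTRW whose generator process $N(t)$ has Sibuya waiting-time density $\psi_\beta(t)=(-1)^{t-1}\binom{\beta}{t}$, $t\in\mathbb{N}$. Then for all $t\in\mathbb{N}_0$ $$\mathbb{E}[Y_t]=2\,\frac{\Gamma(\beta+t+1)}{\Gamma(\beta+1)\,\Gamma(t+1)}-2-t.$$ Moreover, if $\beta\in(0,1)$ then $\mathbb{E}[Y_t]\sim -t$ as $t\to\infty$, whereas if $\beta=1$ then $\mathbb{E}[Y_t]=t$ for all $t\in\mathbb{N}_0$.
   Context: For real $\beta$, $\binom{\beta}{t}=\beta(\beta-1)\cdots(\beta-t+1)/t!$ (for $\beta=1$ the density is $\psi_1(t)=\delta_{t,1}$). The generator process with waiting-time density $\psi$ is the discrete-time renewal counting process $N(t)=\max\{n\ge0:\Delta t_1+\dots+\Delta t_n\le t\}$, $t\in\mathbb{N}_0$, with $\Delta t_1,\Delta t_2,\dots$ i.i.d., $\mathbb{P}(\Delta t_j=t)=\psi(t)$. The simple asymmetric discrete-time random walk (simple ADTRW) is the walk $Y_t=2N(t)-t$ on $\mathbb{Z}$, $Y_0=0$ (jump $+1$ at arrivals of $N$, jump $-1$ otherwise). $f(t)\sim h(t)$ means $f(t)/h(t)\to1$ as $t\to\infty$. *)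

theory Defs
  imports "HOL-Probability.Probability" "HOL-Library.Landau_Symbols"
begin

text \<open>
  Only meaningful for positive \<open>t\<close>: the density lives on the positive integers, and at \<open>t = 0\<close>
  truncated subtraction makes the formula evaluate to 1.
\<close>

definition sibuya_density :: "real \<Rightarrow> nat \<Rightarrow> real" where
  "sibuya_density \<beta> t = (-1) ^ (t - 1) * (\<beta> gchoose t)"

text \<open>
  \<open>X j\<close> is the waiting time \<open>\<Delta>t\<close> with index \<open>j + 1\<close>. Identical distribution is implied by the
  last assumption, and so is \<open>X j \<ge> 1\<close> almost surely whenever \<open>\<psi>\<close> has total mass 1
  on the positive integers.
\<close>

locale iid_waiting_times = prob_space M
  for M :: "'a measure" +
  fixes \<psi> :: "nat \<Rightarrow> real" and X :: "nat \<Rightarrow> 'a \<Rightarrow> nat"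
  assumes indep: "indep_vars (\<lambda>_. count_space UNIV) X UNIV"
    and density: "t \<ge> 1 \<Longrightarrow> prob {\<omega> \<in> space M. X j \<omega> = t} = \<psi> t"

text \<open>
  If all waiting times are positive, the set below is a finite nonempty set of numbers \<open>\<le> t\<close>.
\<close>

definition renewal_count :: "(nat \<Rightarrow> 'a \<Rightarrow> nat) \<Rightarrow> nat \<Rightarrow> 'a \<Rightarrow> nat" where
  "renewal_count X t \<omega> = Max {n. (\<Sum>j<n. X j \<omega>) \<le> t}"

definition simple_adtrw :: "(nat \<Rightarrow> 'a \<Rightarrow> nat) \<Rightarrow> nat \<Rightarrow> 'a \<Rightarrow> int" where
  "simple_adtrw X t \<omega> = 2 * int (renewal_count X t \<omega>) - int t"

definition adtrw_mean :: "'a measure \<Rightarrow> (nat \<Rightarrow> 'a \<Rightarrow> nat) \<Rightarrow> nat \<Rightarrow> real" where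
  "adtrw_mean M X t = (\<integral>\<omega>. real_of_int (simple_adtrw X t \<omega>) \<partial>M)"

end

theory Submission
  imports Defs
begin

text \<open>
  Write \<open>S n\<close> for the sum of the first \<open>n\<close> waiting times. Almost surely every waiting time is
  positive, so \<open>n \<le> S n\<close>, the set \<open>{n. S n \<le> t}\<close> is the initial segment \<open>{0..N(t)}\<close>, and counting it
  gives \<open>N(t) + 1 = (\<Sum>n\<le>t. indicator {S n \<le> t})\<close>. Hence \<open>E N(t) + 1 = (\<Sum>n\<le>t. P(S n \<le> t))\<close>.

  The Sibuya density has generating function \<open>F = 1 - (1 - x)\<^sup>\<beta>\<close>, and by independence \<open>P(S n = k)\<close> is
  the coefficient of \<open>x^k\<close> in \<open>F ^ n\<close>. Summing the geometric series in \<open>F\<close> produces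
  \<open>(1 - x)\<close> to the power \<open>-\<beta>\<close>; the partial sums over \<open>k \<le> t\<close> cost one more factor \<open>1 / (1 - x)\<close>. So
  \<open>E N(t) + 1\<close> is the coefficient of \<open>x^t\<close> in \<open>(1 - x)\<close> to the power \<open>-(\<beta> + 1)\<close>, which is the quotient
  of Gamma values in the theorem (lemmas \<open>sum_renewal_coeffs\<close> and \<open>expectation_renewal_count\<close>).

  That coefficient grows like \<open>t\<close> to the power \<open>\<beta>\<close>, which is \<open>o(t)\<close> for \<open>\<beta> < 1\<close>, so the drift \<open>-t\<close>
  dominates. The decay of \<open>pochhammer c n / fact n\<close> for \<open>c < 1\<close> (lemma \<open>pochhammer_over_fact_tendsto_0\<close>)
  is used twice: for this growth rate, and for showing that \<open>\<psi>\<close> has total mass 1, so that no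
  probability is left for a waiting time 0.
\<close>

unbundle no vec_syntax and fps_syntax

section \<open>Negative binomial series\<close>

text \<open>The binomial series of \<open>(1 - x)\<close> to the power \<open>-c\<close>.\<close>

definition inv_one_minus_X_power :: "real \<Rightarrow> real fps" where
  "inv_one_minus_X_power c = Abs_fps (\<lambda>n. pochhammer c n / fact n)"

lemma inv_one_minus_X_power_add:
  "inv_one_minus_X_power (c + d) = inv_one_minus_X_power c * inv_one_minus_X_power d"
proof (rule fps_ext)
  fix n
  have coeff: "pochhammer x k / fact k = (-1) ^ k * (- x gchoose k)" for x :: real and k
    by (simp add: gbinomial_pochhammer)
  have "inv_one_minus_X_power (c + d) $ n = (-1) ^ n * (- c + - d gchoose n)"
    by (simp add: inv_one_minus_X_power_def coeff)
  also have "\<dots> = (\<Sum>k=0..n. (-1) ^ n * ((- c gchoose k) * (- d gchoose (n - k))))"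
    by (simp only: gbinomial_Vandermonde[symmetric] sum_distrib_left)
  also have "\<dots> = (\<Sum>k=0..n. inv_one_minus_X_power c $ k * inv_one_minus_X_power d $ (n - k))"
  proof (rule sum.cong)
    fix k assume "k \<in> {0..n}"
    then have "(-1::real) ^ n = (-1) ^ k * (-1) ^ (n - k)"
      by (simp flip: power_add)
    then show "(-1) ^ n * ((- c gchoose k) * (- d gchoose (n - k))) =
        inv_one_minus_X_power c $ k * inv_one_minus_X_power d $ (n - k)"
      by (simp add: inv_one_minus_X_power_def coeff)
  qed simp
  finally show "inv_one_minus_X_power (c + d) $ n =
      (inv_one_minus_X_power c * inv_one_minus_X_power d) $ n"
    by (simp add: fps_mult_nth)
qed

lemma inv_one_minus_X_power_0: "inv_one_minus_X_power 0 = 1"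
  by (rule fps_ext) (auto simp: inv_one_minus_X_power_def pochhammer_0_left)

lemma sum_coeffs_conv_mult:
  "(\<Sum>k\<le>n. f $ k) = (f * inv_one_minus_X_power 1) $ n"
proof -
  have "inv_one_minus_X_power 1 $ k = 1" for k
    by (simp add: inv_one_minus_X_power_def pochhammer_fact[symmetric])
  then show ?thesis
    by (simp add: fps_mult_nth atLeast0AtMost)
qed

text \<open>
  Multiplied by \<open>n\<close> to the power \<open>1 - c\<close>, the coefficient converges to \<open>1 / \<Gamma>(c)\<close>, which is Euler's
  limit formula; for \<open>c < 1\<close> the multiplier diverges.
\<close>

lemma pochhammer_over_fact_tendsto_0:
  fixes c :: real
  assumes "c < 1"
  shows "(\<lambda>n. pochhammer c n / fact n) \<longlonglongrightarrow> 0"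
proof -
  have "(\<lambda>n. ((c - 1 + of_nat n) gchoose n) * exp (- (c - 1) * of_real (ln (of_nat n)))) \<longlonglongrightarrow> rGamma c"
    using Gamma_gbinomial[of "c - 1"] by simp
  moreover have "(\<lambda>n. exp ((c - 1) * ln (real n))) \<longlonglongrightarrow> 0"
    using assms
    by (intro filterlim_compose[OF exp_at_bot] filterlim_tendsto_neg_mult_at_bot[OF tendsto_const]
        filterlim_compose[OF ln_at_top] filterlim_real_sequentially) auto
  ultimately have "(\<lambda>n. ((c - 1 + of_nat n) gchoose n) * exp (- (c - 1) * of_real (ln (of_nat n)))
      * exp ((c - 1) * ln (real n))) \<longlonglongrightarrow> rGamma c * 0"
    by (rule tendsto_mult)
  moreover have "((c - 1 + of_nat n) gchoose n) * exp (- (c - 1) * of_real (ln (of_nat n)))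
      * exp ((c - 1) * ln (real n)) = pochhammer c n / fact n" for n
    by (simp add: gbinomial_pochhammer' mult.assoc algebra_simps flip: exp_add)
  ultimately show ?thesis
    by simp
qed

section \<open>Generating function of the Sibuya renewal process\<close>

definition sibuya_fps :: "real \<Rightarrow> real fps" where
  "sibuya_fps \<beta> = 1 - inv_one_minus_X_power (- \<beta>)"

lemma sibuya_fps_nth:
  "sibuya_fps \<beta> $ t = (if t = 0 then 0 else sibuya_density \<beta> t)"
  by (cases t) (simp_all add: sibuya_fps_def inv_one_minus_X_power_def sibuya_density_def
      gbinomial_pochhammer)

lemma sum_sibuya_fps:
  "(\<Sum>t\<le>n. sibuya_fps \<beta> $ t) = 1 - pochhammer (1 - \<beta>) n / fact n"
proof -
  have "sibuya_fps \<beta> * inv_one_minus_X_power 1 =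
      inv_one_minus_X_power 1 - inv_one_minus_X_power (1 - \<beta>)"
    using inv_one_minus_X_power_add[of "- \<beta>" 1] by (simp add: sibuya_fps_def algebra_simps)
  then show ?thesis
    by (simp only: sum_coeffs_conv_mult)
       (simp add: inv_one_minus_X_power_def pochhammer_fact[symmetric])
qed

text \<open>
  Since \<open>F = sibuya_fps \<beta>\<close> has no constant term, the powers \<open>F ^ n\<close> with \<open>n > t\<close> do not contribute to
  the coefficient of \<open>x^t\<close>, so the finite geometric sum is as good as \<open>1 / (1 - F)\<close> there.
\<close>

lemma sum_renewal_coeffs:
  "(\<Sum>n\<le>t. \<Sum>k\<le>t. (sibuya_fps \<beta> ^ n) $ k) = pochhammer (\<beta> + 1) t / fact t"
proof -
  let ?F = "sibuya_fps \<beta>" and ?G = inv_one_minus_X_power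
  have "?G (\<beta> + 1) = ?G \<beta> * ?G 1"
    by (rule inv_one_minus_X_power_add)
  moreover have "?G \<beta> * ?G (- \<beta>) = 1"
    using inv_one_minus_X_power_add[of \<beta> "- \<beta>"] by (simp add: inv_one_minus_X_power_0)
  moreover have "?G (- \<beta>) * (\<Sum>n\<le>t. ?F ^ n) = 1 - ?F ^ Suc t"
    using sum_gp_basic[of ?F t] by (simp add: sibuya_fps_def)
  ultimately have "(\<Sum>n\<le>t. ?F ^ n) * ?G 1 = ?G (\<beta> + 1) - ?F ^ Suc t * ?G (\<beta> + 1)"
    by (metis (no_types, opaque_lifting) mult.assoc mult.commute mult.left_neutral left_diff_distrib)
  moreover have "(?F ^ Suc t * ?G (\<beta> + 1)) $ t = 0"
  proof -
    have "?F $ 0 = 0"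
      by (simp add: sibuya_fps_nth)
    then have "(?F ^ Suc t) $ k = 0" if "k \<le> t" for k
      using startsby_zero_power_prefix[of ?F "Suc t"] that by simp
    then show ?thesis
      by (simp add: fps_mult_nth del: power_Suc)
  qed
  ultimately have "((\<Sum>n\<le>t. ?F ^ n) * ?G 1) $ t = ?G (\<beta> + 1) $ t"
    by (simp del: power_Suc)
  moreover have "((\<Sum>n\<le>t. ?F ^ n) * ?G 1) $ t = (\<Sum>n\<le>t. \<Sum>k\<le>t. (?F ^ n) $ k)"
    by (simp add: sum_distrib_right fps_sum_nth sum_coeffs_conv_mult)
  ultimately show ?thesis
    by (simp add: inv_one_minus_X_power_def)
qed

section \<open>Sums of independent waiting times\<close>

text \<open>
  The distribution of a sum of independent variables is the convolution of their distributions,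
  and convolution of sequences is multiplication of power series.
\<close>

lemma (in prob_space) prob_sum_eq_fps_power:
  fixes X :: "nat \<Rightarrow> 'a \<Rightarrow> nat" and F :: "real fps"
  assumes indep: "indep_vars (\<lambda>_. count_space UNIV) X UNIV"
    and distr: "\<And>j t. prob {\<omega> \<in> space M. X j \<omega> = t} = F $ t"
  shows "prob {\<omega> \<in> space M. (\<Sum>j<n. X j \<omega>) = k} = (F ^ n) $ k"
proof (induction n arbitrary: k)
  case 0
  show ?case
    by (cases "k = 0") (simp_all add: prob_space)
next
  case (Suc n)
  let ?S = "\<lambda>\<omega>. \<Sum>j<n. X j \<omega>"
  have meas [measurable]: "X j \<in> measurable M (count_space UNIV)" for j
    using indep by (auto simp: indep_vars_def)
  have "indep_vars (\<lambda>_. borel) (\<lambda>j \<omega>. real (X j \<omega>)) (insert n {..<n})"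
    by (rule indep_vars_subset[OF indep_vars_compose2[OF indep]]) auto
  then have ind: "indep_var borel (\<lambda>\<omega>. real (X n \<omega>)) borel (\<lambda>\<omega>. \<Sum>j<n. real (X j \<omega>))"
    by (intro indep_vars_sum) auto
  have split: "prob {\<omega> \<in> space M. ?S \<omega> = i \<and> X n \<omega> = k - i} = (F ^ n) $ i * F $ (k - i)" for i
  proof -
    have "prob ((\<lambda>\<omega>. (real (X n \<omega>), \<Sum>j<n. real (X j \<omega>))) -` ({real (k - i)} \<times> {real i}) \<inter> space M)
        = prob ((\<lambda>\<omega>. real (X n \<omega>)) -` {real (k - i)} \<inter> space M) *
          prob ((\<lambda>\<omega>. \<Sum>j<n. real (X j \<omega>)) -` {real i} \<inter> space M)"
      by (rule indep_varD[OF ind]) auto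
    moreover have "(\<lambda>\<omega>. (real (X n \<omega>), \<Sum>j<n. real (X j \<omega>))) -` ({real (k - i)} \<times> {real i}) \<inter> space M
        = {\<omega> \<in> space M. ?S \<omega> = i \<and> X n \<omega> = k - i}"
      by (auto simp flip: of_nat_sum)
    moreover have "(\<lambda>\<omega>. real (X n \<omega>)) -` {real (k - i)} \<inter> space M = {\<omega> \<in> space M. X n \<omega> = k - i}"
      by auto
    moreover have "(\<lambda>\<omega>. \<Sum>j<n. real (X j \<omega>)) -` {real i} \<inter> space M = {\<omega> \<in> space M. ?S \<omega> = i}"
      by (auto simp flip: of_nat_sum)
    ultimately show ?thesis
      using Suc.IH[of i] distr[of n "k - i"] by simp
  qed
  have "{\<omega> \<in> space M. (\<Sum>j<Suc n. X j \<omega>) = k} =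
      (\<Union>i\<le>k. {\<omega> \<in> space M. ?S \<omega> = i \<and> X n \<omega> = k - i})"
    by auto
  also have "prob \<dots> = (\<Sum>i\<le>k. prob {\<omega> \<in> space M. ?S \<omega> = i \<and> X n \<omega> = k - i})"
    by (rule finite_measure_finite_Union) (auto simp: disjoint_family_on_def)
  also have "\<dots> = (F ^ Suc n) $ k"
    by (simp only: split power_Suc2 fps_mult_nth atLeast0AtMost)
  finally show ?case .
qed

lemma (in prob_space) prob_sum_le_fps_power:
  fixes X :: "nat \<Rightarrow> 'a \<Rightarrow> nat" and F :: "real fps"
  assumes indep: "indep_vars (\<lambda>_. count_space UNIV) X UNIV"
    and distr: "\<And>j t. prob {\<omega> \<in> space M. X j \<omega> = t} = F $ t"
  shows "prob {\<omega> \<in> space M. (\<Sum>j<n. X j \<omega>) \<le> t} = (\<Sum>k\<le>t. (F ^ n) $ k)"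
proof -
  have [measurable]: "X j \<in> measurable M (count_space UNIV)" for j
    using indep by (auto simp: indep_vars_def)
  have "{\<omega> \<in> space M. (\<Sum>j<n. X j \<omega>) \<le> t} = (\<Union>k\<le>t. {\<omega> \<in> space M. (\<Sum>j<n. X j \<omega>) = k})"
    by auto
  also have "prob \<dots> = (\<Sum>k\<le>t. prob {\<omega> \<in> space M. (\<Sum>j<n. X j \<omega>) = k})"
    by (rule finite_measure_finite_Union) (auto simp: disjoint_family_on_def)
  finally show ?thesis
    by (simp add: prob_sum_eq_fps_power[OF indep distr])
qed

section \<open>The renewal count\<close>

text \<open>
  The partial sums increase strictly, so the epochs up to \<open>t\<close>, together with the epoch 0, are the
  initial segment \<open>{0..N(t)}\<close>. Turning the maximum into a count makes the expectation additive.
\<close>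

lemma renewal_count_eq_sum:
  assumes pos: "\<And>j. X j \<omega> > 0"
  shows "real (renewal_count X t \<omega>) + 1 = (\<Sum>n\<le>t. of_bool ((\<Sum>j<n. X j \<omega>) \<le> t))"
proof -
  let ?A = "{n. (\<Sum>j<n. X j \<omega>) \<le> t}"
  have "n \<le> (\<Sum>j<n. X j \<omega>)" for n
    using sum_bounded_below[of "{..<n}" 1 "\<lambda>j. X j \<omega>"] pos by (simp add: Suc_le_eq)
  then have sub: "?A \<subseteq> {..t}"
    using order_trans by fastforce
  then have fin: "finite ?A"
    using finite_subset by blast
  moreover have "0 \<in> ?A"
    by simp
  ultimately have max: "Max ?A \<in> ?A"
    using Max_in by blast
  have "?A = {..Max ?A}"
  proof (intro equalityI subsetI)
    fix n assume "n \<in> {..Max ?A}"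
    then have "(\<Sum>j<n. X j \<omega>) \<le> (\<Sum>j<Max ?A. X j \<omega>)"
      by (intro sum_mono2) auto
    with max show "n \<in> ?A"
      by simp
  qed (use fin in simp)
  then have "card ?A = Suc (Max ?A)"
    by (metis card_atMost)
  moreover have "(\<Sum>n\<le>t. of_bool ((\<Sum>j<n. X j \<omega>) \<le> t)) = real (card ({..t} \<inter> ?A))"
    by (simp add: of_bool_def sum.If_cases)
  moreover have "{..t} \<inter> ?A = ?A"
    using sub by blast
  ultimately show ?thesis
    by (simp add: renewal_count_def)
qed

context iid_waiting_times
begin

lemma measurable_waiting_time [measurable]: "X j \<in> measurable M (count_space UNIV)"
  using indep by (auto simp: indep_vars_def)

lemma measurable_renewal_count [measurable]:
  "renewal_count X t \<in> measurable M (count_space UNIV)"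
  unfolding renewal_count_def[abs_def] by measurable

end

locale sibuya_waiting_times = iid_waiting_times M "sibuya_density \<beta>" X
  for M :: "'a measure" and \<beta> :: real and X +
  assumes beta_pos: "0 < \<beta>"
begin

text \<open>
  The mass \<open>P(1 \<le> X j \<le> n)\<close> is \<open>1 - pochhammer (1 - \<beta>) n / fact n\<close>, which tends to 1 because \<open>\<beta> > 0\<close>.
\<close>

lemma prob_waiting_time_0: "prob {\<omega> \<in> space M. X j \<omega> = 0} = 0"
proof -
  have "prob {\<omega> \<in> space M. X j \<omega> = 0} \<le> pochhammer (1 - \<beta>) n / fact n" for n
  proof -
    have "prob {\<omega> \<in> space M. X j \<omega> = 0} + (\<Sum>t\<in>{1..n}. sibuya_density \<beta> t)
        = (\<Sum>t\<in>{0..n}. prob {\<omega> \<in> space M. X j \<omega> = t})"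
      by (simp add: sum.atLeast_Suc_atMost density)
    also have "\<dots> = prob (\<Union>t\<in>{0..n}. {\<omega> \<in> space M. X j \<omega> = t})"
      by (rule finite_measure_finite_Union[symmetric]) (auto simp: disjoint_family_on_def)
    also have "\<dots> \<le> 1"
      by simp
    also have "(\<Sum>t\<in>{1..n}. sibuya_density \<beta> t) = (\<Sum>t\<le>n. sibuya_fps \<beta> $ t)"
      by (simp add: sibuya_fps_nth sum.atLeast_Suc_atMost flip: atLeast0AtMost)
    finally show ?thesis
      by (simp add: sum_sibuya_fps)
  qed
  moreover have "(\<lambda>n. pochhammer (1 - \<beta>) n / fact n) \<longlonglongrightarrow> 0"
    using beta_pos by (intro pochhammer_over_fact_tendsto_0) simp
  ultimately have "prob {\<omega> \<in> space M. X j \<omega> = 0} \<le> 0"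
    by (intro LIMSEQ_le_const) auto
  then show ?thesis
    by (simp add: measure_le_0_iff)
qed

lemma prob_waiting_time: "prob {\<omega> \<in> space M. X j \<omega> = t} = sibuya_fps \<beta> $ t"
  by (cases "t = 0") (simp_all add: sibuya_fps_nth prob_waiting_time_0 density)

lemma AE_waiting_times_pos: "AE \<omega> in M. \<forall>j. X j \<omega> > 0"
proof -
  have "AE \<omega> in M. X j \<omega> > 0" for j
    using prob_waiting_time_0[of j] by (subst (asm) prob_eq_0) auto
  then show ?thesis
    by (simp add: AE_all_countable)
qed

lemma integrable_indicator_sum_le:
  "integrable M (indicator {\<omega> \<in> space M. (\<Sum>j<n. X j \<omega>) \<le> t} :: 'a \<Rightarrow> real)"
  by (rule integrable_real_indicator) (auto simp: emeasure_eq_measure)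

lemma AE_renewal_count:
  "AE \<omega> in M. real (renewal_count X t \<omega>) =
    (\<Sum>n\<le>t. indicator {\<omega> \<in> space M. (\<Sum>j<n. X j \<omega>) \<le> t} \<omega>) - 1"
  using AE_waiting_times_pos AE_space
proof eventually_elim
  case (elim \<omega>)
  then show ?case
    using renewal_count_eq_sum[of X \<omega> t] by (simp add: indicator_def of_bool_def)
qed

lemma integrable_renewal_count: "integrable M (\<lambda>\<omega>. real (renewal_count X t \<omega>))"
proof -
  have "integrable M (\<lambda>\<omega>. (\<Sum>n\<le>t. indicator {\<omega> \<in> space M. (\<Sum>j<n. X j \<omega>) \<le> t} \<omega>) - 1 :: real)"
    by (intro Bochner_Integration.integrable_diff Bochner_Integration.integrable_sum
        integrable_indicator_sum_le) auto
  then show ?thesis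
    by (rule integrable_cong_AE_imp) (use AE_renewal_count[of t] in auto)
qed

lemma expectation_renewal_count:
  "expectation (\<lambda>\<omega>. real (renewal_count X t \<omega>)) = pochhammer (\<beta> + 1) t / fact t - 1"
proof -
  have "expectation (\<lambda>\<omega>. real (renewal_count X t \<omega>)) =
      expectation (\<lambda>\<omega>. (\<Sum>n\<le>t. indicator {\<omega> \<in> space M. (\<Sum>j<n. X j \<omega>) \<le> t} \<omega>) - 1)"
    by (rule integral_cong_AE) (use AE_renewal_count[of t] in auto)
  also have "\<dots> = (\<Sum>n\<le>t. prob {\<omega> \<in> space M. (\<Sum>j<n. X j \<omega>) \<le> t}) - 1"
    by (simp add: integrable_indicator_sum_le prob_space Int_def conj_commute
        cong: conj_cong)
  also have "\<dots> = (\<Sum>n\<le>t. \<Sum>k\<le>t. (sibuya_fps \<beta> ^ n) $ k) - 1"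
    by (simp only: prob_sum_le_fps_power[OF indep prob_waiting_time])
  finally show ?thesis
    by (simp only: sum_renewal_coeffs)
qed

lemma integrable_simple_adtrw: "integrable M (\<lambda>\<omega>. real_of_int (simple_adtrw X t \<omega>))"
  using integrable_renewal_count by (simp add: simple_adtrw_def)

lemma adtrw_mean_eq_pochhammer:
  "adtrw_mean M X t = 2 * (pochhammer (\<beta> + 1) t / fact t) - 2 - real t"
  using integrable_renewal_count expectation_renewal_count
  by (simp add: adtrw_mean_def simple_adtrw_def prob_space)

lemma adtrw_mean_eq_Gamma:
  "adtrw_mean M X t =
    2 * (Gamma (\<beta> + real t + 1) / (Gamma (\<beta> + 1) * Gamma (real t + 1))) - 2 - real t"
proof -
  have "\<beta> + 1 \<notin> \<int>\<^sub>\<le>\<^sub>0"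
    using beta_pos by (auto elim!: nonpos_Ints_cases)
  then have "pochhammer (\<beta> + 1) t = Gamma (\<beta> + real t + 1) / Gamma (\<beta> + 1)"
    by (simp add: pochhammer_Gamma add_ac)
  moreover have "Gamma (real t + 1) = fact t"
    using Gamma_fact[of t, where 'a = real] by (simp add: add.commute)
  ultimately show ?thesis
    by (simp add: adtrw_mean_eq_pochhammer)
qed

text \<open>
  The identity \<open>pochhammer (\<beta> + 1) t = (1 + t / \<beta>) * pochhammer \<beta> t\<close> reduces the claim that the Gamma
  quotient is \<open>o(t)\<close> to the decay lemma at \<open>c = \<beta>\<close>.
\<close>

lemma adtrw_mean_asymp_equiv:
  assumes "\<beta> < 1"
  shows "adtrw_mean M X \<sim>[at_top] (\<lambda>t. - real t)"
proof (rule asymp_equivI')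
  let ?r = "\<lambda>t. pochhammer \<beta> t / fact t"
  have r: "?r \<longlonglongrightarrow> 0"
    using assms by (rule pochhammer_over_fact_tendsto_0)
  have inv: "(\<lambda>t. 1 / real t) \<longlonglongrightarrow> 0"
    by (rule lim_1_over_n)
  have "(\<lambda>t. 1 + 2 * (1 / real t) - 2 * ((1 / real t + 1 / \<beta>) * ?r t)) \<longlonglongrightarrow>
      1 + 2 * 0 - 2 * ((0 + 1 / \<beta>) * 0)"
    by (intro tendsto_intros r inv)
  moreover have "\<forall>\<^sub>F t in at_top. 1 + 2 * (1 / real t) - 2 * ((1 / real t + 1 / \<beta>) * ?r t) =
      adtrw_mean M X t / (- real t)"
    using eventually_gt_at_top[of 0]
  proof eventually_elim
    case (elim t)
    have "\<beta> * pochhammer (\<beta> + 1) t = (\<beta> + real t) * pochhammer \<beta> t"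
      by (metis pochhammer_rec pochhammer_rec')
    then have "pochhammer (\<beta> + 1) t = (\<beta> + real t) * pochhammer \<beta> t / \<beta>"
      using beta_pos by (simp add: field_simps)
    then have "adtrw_mean M X t = 2 * ((\<beta> + real t) / \<beta> * ?r t) - 2 - real t"
      by (simp add: adtrw_mean_eq_pochhammer)
    moreover have "1 + 2 * (1 / x) - 2 * ((1 / x + 1 / \<beta>) * r) =
        (2 * ((\<beta> + x) / \<beta> * r) - 2 - x) / (- x)" if "0 < x" for x r :: real
      using that beta_pos by (simp add: field_simps)
    ultimately show ?case
      using elim by (simp only: of_nat_0_less_iff)
  qed
  ultimately show "(\<lambda>t. adtrw_mean M X t / (- real t)) \<longlonglongrightarrow> 1"
    by (simp add: Lim_transform_eventually)
qed

end

theorem mainTheorem9: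
  fixes \<beta> :: real and M :: "'a measure" and X :: "nat \<Rightarrow> 'a \<Rightarrow> nat"
  assumes "0 < \<beta>" and "\<beta> \<le> 1"
    and "iid_waiting_times M (sibuya_density \<beta>) X"
  shows "(\<forall>t::nat. integrable M (\<lambda>\<omega>. real_of_int (simple_adtrw X t \<omega>)) \<and>
            adtrw_mean M X t =
              2 * (Gamma (\<beta> + real t + 1) / (Gamma (\<beta> + 1) * Gamma (real t + 1))) - 2 - real t) \<and>
         (\<beta> < 1 \<longrightarrow> adtrw_mean M X \<sim>[at_top] (\<lambda>t. - real t)) \<and>
         (\<beta> = 1 \<longrightarrow> (\<forall>t::nat. adtrw_mean M X t = real t))"
proof -
  interpret sibuya_waiting_times M \<beta> X
    using assms by (simp add: sibuya_waiting_times_def sibuya_waiting_times_axioms_def)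
  have "adtrw_mean M X t = real t" if "\<beta> = 1" for t
  proof -
    have "pochhammer 2 t = (fact (Suc t) :: real)"
      using pochhammer_rec[of "1::real" t] by (simp add: pochhammer_fact)
    then show ?thesis
      using that by (simp add: adtrw_mean_eq_pochhammer)
  qed
  then show ?thesis
    using integrable_simple_adtrw adtrw_mean_eq_Gamma adtrw_mean_asymp_equiv by blast
qed

end
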